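(* A property $\mathcal{P}$ of strings over a finite alphabet $\Sigma$ is canonically testable if and only if it is earthmover resilient.
   Context: A string is a function $S\colon[n]\to\Sigma$; a string property is any set of strings (over all lengths $n$). Relative Hamming distance $d_H(S,S')=|\{x:S(x)\ne S'(x)\}|/n$; $d_H(S,\mathcal{P})$ is the minimum over $S'\in\mathcal{P}$ of length $n$; $S$ is $\epsilon$-far from $\mathcal{P}$ if $d_H(S,\mathcal{P})>\epsilon$, and $\epsilon$-close otherwise. A basic move swaps two consecutive entries $x,x+1$ of the string. $D_e(S,S')$ is the minimum number of basic moves transforming $S$ into $S'$ ($+\infty$ if impossible) and $d_e(S,S')=D_e(S,S')/\binom{n}{2}$. $\mathcal{P}$ is $\delta$-earthmover resilient (for $\delta\colon(0,1)\to(0,1)$) if for all $\epsilon\in(0,1)$, $S\in\mathcal{P}$ and $S'$ with $d_e(S,S')\le\delta(\epsilon)$, $S'$ is $\epsilon$-close to $\mathcal{P}$; earthmover resilient means $\delta$-earthmover resilient for some $\delta$. A canonical $q$-query test picks $x_1<\dots<x_q$ uniformly at random from $[n]$, queries $y_i=S(x_i)$, and accepts or rejects (possibly randomly) based only on the tuple $(y_1,\dots,y_q)$ (not on the $x_i$). It is an $\epsilon$-test if it accepts every $S\in\mathcal{P}$ with probability $\ge2/3$ and rejects every $S$ that is $\epsilon$-far from $\mathcal{P}$ with probability $\ge2/3$. $\mathcal{P}$ is canonically testable if for every $\epsilon>0$ it has a canonical $\epsilon$-test whose number of queries depends only on $\epsilon$. *)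

theory Defs
  imports "HOL-Probability.Probability"
begin

text \<open>
  A string of length \<open>n\<close> over the alphabet \<open>'a\<close> is a list of length \<open>n\<close>, with positions
  \<open>0, \<dots>, n - 1\<close> instead of \<open>1, \<dots>, n\<close>; a property is a set of lists, of any lengths.
\<close>

definition hamming_dist :: "'a list \<Rightarrow> 'a list \<Rightarrow> real" where
  "hamming_dist S S' = real (card {x. x < length S \<and> S ! x \<noteq> S' ! x}) / real (length S)"

text \<open>
  The distance is \<open>\<infinity>\<close> if the property has no string of the length of \<open>S\<close>; otherwise the
  infimum ranges over finitely many values and is a minimum.
\<close>

definition hamming_dist_property :: "'a list \<Rightarrow> 'a list set \<Rightarrow> ereal" where
  "hamming_dist_property S P = (INF S'\<in>{S'\<in>P. length S' = length S}. ereal (hamming_dist S S'))"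

definition eps_far :: "real \<Rightarrow> 'a list \<Rightarrow> 'a list set \<Rightarrow> bool" where
  "eps_far \<epsilon> S P \<longleftrightarrow> hamming_dist_property S P > ereal \<epsilon>"

abbreviation eps_close :: "real \<Rightarrow> 'a list \<Rightarrow> 'a list set \<Rightarrow> bool" where
  "eps_close \<epsilon> S P \<equiv> \<not> eps_far \<epsilon> S P"

definition basic_move :: "'a list \<Rightarrow> 'a list \<Rightarrow> bool" where
  "basic_move S S' \<longleftrightarrow> (\<exists>x. Suc x < length S \<and> S' = S[x := S ! Suc x, Suc x := S ! x])"

text \<open>
  The infimum of the empty set in \<^typ>\<open>enat\<close> is \<open>\<infinity>\<close>.
\<close>

definition earthmover_moves :: "'a list \<Rightarrow> 'a list \<Rightarrow> enat" where
  "earthmover_moves S S' = (INF k\<in>{k. (basic_move ^^ k) S S'}. enat k)"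

text \<open>
  If \<^prop>\<open>length S < 2\<close>, the denominator is \<open>0\<close>. Since \<open>0 / 0 = 0\<close> and \<open>\<infinity> / 0 = \<infinity>\<close> in
  \<^typ>\<open>ereal\<close>, the distance is then \<open>0\<close> for \<^prop>\<open>S' = S\<close> and \<open>\<infinity>\<close> for every other \<open>S'\<close>.
\<close>

definition earthmover_dist :: "'a list \<Rightarrow> 'a list \<Rightarrow> ereal" where
  "earthmover_dist S S' =
     ereal_of_enat (earthmover_moves S S') / ereal (real (length S choose 2))"

definition delta_earthmover_resilient :: "(real \<Rightarrow> real) \<Rightarrow> 'a list set \<Rightarrow> bool" where
  "delta_earthmover_resilient \<delta> P \<longleftrightarrow>
     (\<forall>\<epsilon>\<in>{0<..<1}. \<forall>S\<in>P. \<forall>S'. earthmover_dist S S' \<le> ereal (\<delta> \<epsilon>) \<longrightarrow> eps_close \<epsilon> S' P)"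

definition earthmover_resilient :: "'a list set \<Rightarrow> bool" where
  "earthmover_resilient P \<longleftrightarrow>
     (\<exists>\<delta>. \<delta> \<in> {0<..<1} \<rightarrow> {0<..<1} \<and> delta_earthmover_resilient \<delta> P)"

text \<open>
  A canonical test is given by its number \<open>q\<close> of queries and its randomized decision rule \<open>A\<close>.
  As usual in property testing, the length \<open>n\<close> of the input is known to the test, so the rule is
  a function of \<open>n\<close> and of the tuple of answers; it does not see the queried positions. The set
  \<open>X\<close> is \<open>{x\<^sub>1 < \<dots> < x\<^sub>q}\<close>, and \<^term>\<open>nths S X\<close> lists the entries of \<open>S\<close> at these positions
  in increasing order. A string with fewer than \<open>q\<close> entries is queried completely.
\<close>

definition canonical_test_run ::
    "nat \<Rightarrow> (nat \<Rightarrow> 'a list \<Rightarrow> bool pmf) \<Rightarrow> 'a list \<Rightarrow> bool pmf" where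
  "canonical_test_run q A S =
     bind_pmf (pmf_of_set {X. X \<subseteq> {..<length S} \<and> card X = min q (length S)})
       (\<lambda>X. A (length S) (nths S X))"

definition canonical_eps_test ::
    "real \<Rightarrow> 'a list set \<Rightarrow> nat \<Rightarrow> (nat \<Rightarrow> 'a list \<Rightarrow> bool pmf) \<Rightarrow> bool" where
  "canonical_eps_test \<epsilon> P q A \<longleftrightarrow>
     (\<forall>S\<in>P. pmf (canonical_test_run q A S) True \<ge> 2 / 3) \<and>
     (\<forall>S. eps_far \<epsilon> S P \<longrightarrow> pmf (canonical_test_run q A S) False \<ge> 2 / 3)"

definition canonically_testable :: "'a list set \<Rightarrow> bool" where
  "canonically_testable P \<longleftrightarrow> (\<forall>\<epsilon>>0. \<exists>q A. canonical_eps_test \<epsilon> P q A)"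

end

theory Submission
  imports Defs
begin

text \<open>
  If \<open>X\<close> does not contain both positions of a basic move, then applying the transposition of these
  positions to \<open>X\<close> compensates the move. Hence a move changes the acceptance probability of a
  canonical test by at most the probability of sampling both positions, about \<open>q\<^sup>2 / n\<^sup>2\<close>, and
  \<open>\<delta> n\<^sup>2 / 2\<close> moves change it by \<open>O(\<delta> q\<^sup>2)\<close>. So a canonically testable property is earthmover
  resilient.

  Conversely, cut the positions into \<open>k\<close> blocks. By the second moment method most samples reproduce,
  up to a small error, the number of occurrences of every letter in every prefix that is a union of
  blocks; call them representative. The test accepts if the answers are those of a representative
  sample of some string \<open>S'\<close> in the property. If the same answers also come from a representative
  sample of \<open>S\<close>, then \<open>S\<close> and \<open>S'\<close> have almost the same letter counts in each block, so that a
  few letter changes in \<open>S\<close> yield a string \<open>S''\<close> whose blocks are permutations of those of \<open>S'\<close>.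
  Sorting within the blocks takes about \<open>n\<^sup>2 / (2 k)\<close> moves, so resilience makes \<open>S''\<close>, and hence
  \<open>S\<close>, close to the property.
\<close>

section \<open>Counting subsets\<close>

text \<open>Deleting \<open>D\<close> is a bijection onto the subsets of \<open>A - D\<close> of the
  remaining size. Without \<open>card D \<le> m\<close> the difference would truncate to 0 and the
  binomial would be 1 instead of 0.\<close>

lemma card_subsets_containing:
  assumes "finite A" "D \<subseteq> A" "card D \<le> m"
  shows "card {X. X \<subseteq> A \<and> card X = m \<and> D \<subseteq> X} = (card A - card D) choose (m - card D)"
proof -
  have fD: "finite D" using assms finite_subset by blast
  have "bij_betw (\<lambda>Y. Y \<union> D) {Y. Y \<subseteq> A - D \<and> card Y = m - card D}
          {X. X \<subseteq> A \<and> card X = m \<and> D \<subseteq> X}"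
  proof (rule bij_betw_byWitness[where f' = "\<lambda>X. X - D"])
    show "(\<lambda>Y. Y \<union> D) ` {Y. Y \<subseteq> A - D \<and> card Y = m - card D}
        \<subseteq> {X. X \<subseteq> A \<and> card X = m \<and> D \<subseteq> X}"
    proof clarify
      fix Y assume Y: "Y \<subseteq> A - D" "card Y = m - card D"
      have "finite Y" using Y(1) assms(1) finite_subset by blast
      hence "card (Y \<union> D) = card Y + card D"
        using Y(1) fD by (intro card_Un_disjoint) auto
      thus "Y \<union> D \<subseteq> A \<and> card (Y \<union> D) = m \<and> D \<subseteq> Y \<union> D"
        using Y assms by auto
    qed
    show "(\<lambda>X. X - D) ` {X. X \<subseteq> A \<and> card X = m \<and> D \<subseteq> X}
        \<subseteq> {Y. Y \<subseteq> A - D \<and> card Y = m - card D}"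
      using fD by (auto simp: card_Diff_subset)
  qed auto
  hence "card {X. X \<subseteq> A \<and> card X = m \<and> D \<subseteq> X} = card {Y. Y \<subseteq> A - D \<and> card Y = m - card D}"
    by (simp add: bij_betw_same_card)
  also have "\<dots> = card (A - D) choose (m - card D)"
    using assms(1) by (simp add: n_subsets)
  also have "card (A - D) = card A - card D"
    using assms fD by (simp add: card_Diff_subset)
  finally show ?thesis .
qed

lemma card_subsets_containing_point:
  assumes "finite A" "x \<in> A"
  shows "card A * card {X. X \<subseteq> A \<and> card X = m \<and> x \<in> X} = m * (card A choose m)"
proof (cases m)
  case 0
  have "{X. X \<subseteq> A \<and> card X = 0 \<and> x \<in> X} = {}"
    using assms finite_subset by fastforce
  thus ?thesis unfolding 0 by (simp only: card.empty mult_0_right mult_0)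
next
  case (Suc k)
  have "card {X. X \<subseteq> A \<and> card X = m \<and> x \<in> X} = (card A - 1) choose k"
    using card_subsets_containing[of A "{x}" m] assms Suc by simp
  moreover have "card A > 0" using assms card_gt_0_iff by blast
  ultimately show ?thesis
    using Suc binomial_absorption[of k "card A"] by simp
qed

text \<open>The absorption identity for binomials is applied twice. Read as a probability, the
  result bounds the effect of a basic move and gives the mixed terms of the second moment.\<close>

lemma card_subsets_containing_pair:
  assumes "finite A" "x \<in> A" "y \<in> A" "x \<noteq> y"
  shows "card {X. X \<subseteq> A \<and> card X = m \<and> x \<in> X \<and> y \<in> X} * (card A * (card A - 1))
    = (card A choose m) * (m * (m - 1))"
proof (cases "m \<ge> 2")
  case False
  have "{X. X \<subseteq> A \<and> card X = m \<and> x \<in> X \<and> y \<in> X} = {}"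
  proof (rule ccontr)
    assume "\<not> ?thesis"
    then obtain X where X: "X \<subseteq> A" "card X = m" "{x, y} \<subseteq> X" by auto
    hence "card {x, y} \<le> card X" using assms finite_subset card_mono by metis
    thus False using X False assms by simp
  qed
  moreover have "m * (m - 1) = 0" using False by auto
  ultimately show ?thesis by (simp only: card.empty mult_0_right mult_0)
next
  case True
  then obtain k where k: "m = Suc (Suc k)" by (metis add_2_eq_Suc le_Suc_ex)
  have "card {x, y} \<le> card A" using assms by (intro card_mono) auto
  hence "card A \<ge> 2" using assms by simp
  then obtain l where l: "card A = Suc (Suc l)" by (metis add_2_eq_Suc le_Suc_ex)
  have "card {X. X \<subseteq> A \<and> card X = m \<and> x \<in> X \<and> y \<in> X} = l choose k"
    using card_subsets_containing[of A "{x, y}" m] assms True l k by simp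
  moreover have "Suc l * (l choose k) = Suc k * (Suc l choose Suc k)"
    by (simp only: Suc_times_binomial_eq mult.commute)
  moreover have "Suc (Suc l) * (Suc l choose Suc k) = Suc (Suc k) * (Suc (Suc l) choose Suc (Suc k))"
    by (simp only: Suc_times_binomial_eq mult.commute)
  ultimately show ?thesis unfolding l k diff_Suc_1
    by (metis mult.assoc mult.commute)
qed

text \<open>Expanding the square leaves the number of subsets containing \<open>x\<close> and
  \<open>y\<close> as coefficient of \<open>f x * f y\<close>. It is the same
  \<open>c \<ge> 0\<close> for all distinct pairs, so \<open>sum f A = 0\<close> makes the mixed
  terms contribute a nonpositive amount, and the diagonal remains.\<close>

lemma sum_subsets_second_moment:
  fixes f :: "'b \<Rightarrow> real"
  assumes fin: "finite A" and zero: "sum f A = 0" and bnd: "\<And>x. x \<in> A \<Longrightarrow> (f x)\<^sup>2 \<le> 1"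
  shows "(\<Sum>X | X \<subseteq> A \<and> card X = m. (sum f X)\<^sup>2) \<le> real m * real (card A choose m)"
proof -
  let ?F = "{X. X \<subseteq> A \<and> card X = m}"
  let ?M = "\<lambda>x y. real (card {X. X \<subseteq> A \<and> card X = m \<and> x \<in> X \<and> y \<in> X})"
  have finF: "finite ?F" using fin by simp
  define c where "c = real (card A choose m) * real (m * (m - 1)) / real (card A * (card A - 1))"
  have c: "?M x y = c" if "x \<in> A" "y \<in> A" "x \<noteq> y" for x y
  proof -
    have "card {x, y} \<le> card A" using that fin by (intro card_mono) auto
    hence "real (card A * (card A - 1)) \<noteq> 0" using that by simp
    thus ?thesis
      using card_subsets_containing_pair[OF fin that, of m] unfolding c_def
      by (simp add: eq_divide_eq flip: of_nat_mult)
  qed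
  have c0: "c \<ge> 0" unfolding c_def by simp
  have "(\<Sum>X\<in>?F. (sum f X)\<^sup>2) = (\<Sum>X\<in>?F. \<Sum>x\<in>A. \<Sum>y\<in>A. if x \<in> X \<and> y \<in> X then f x * f y else 0)"
  proof (rule sum.cong[OF refl])
    fix X assume "X \<in> ?F"
    hence "sum f X = (\<Sum>x\<in>A. if x \<in> X then f x else 0)"
      using fin by (subst sum.inter_restrict[symmetric]) (auto intro!: sum.cong)
    hence "(sum f X)\<^sup>2 = (\<Sum>x\<in>A. \<Sum>y\<in>A. (if x \<in> X then f x else 0) * (if y \<in> X then f y else 0))"
      by (simp add: power2_eq_square sum_product)
    also have "\<dots> = (\<Sum>x\<in>A. \<Sum>y\<in>A. if x \<in> X \<and> y \<in> X then f x * f y else 0)"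
      by (intro sum.cong) auto
    finally show "(sum f X)\<^sup>2 = \<dots>" .
  qed
  also have "\<dots> = (\<Sum>x\<in>A. \<Sum>y\<in>A. \<Sum>X\<in>?F. if x \<in> X \<and> y \<in> X then f x * f y else 0)"
    by (subst sum.swap) (intro sum.cong refl sum.swap)
  also have "\<dots> = (\<Sum>x\<in>A. \<Sum>y\<in>A. ?M x y * (f x * f y))"
  proof (intro sum.cong refl)
    fix x y
    have "(\<Sum>X\<in>?F. if x \<in> X \<and> y \<in> X then f x * f y else 0)
        = (\<Sum>X\<in>{X\<in>?F. x \<in> X \<and> y \<in> X}. f x * f y)"
      using finF by (rule sum.inter_filter [symmetric])
    thus "(\<Sum>X\<in>?F. if x \<in> X \<and> y \<in> X then f x * f y else 0) = ?M x y * (f x * f y)"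
      by (simp add: conj_assoc)
  qed
  also have "\<dots> = (\<Sum>x\<in>A. (?M x x - c) * (f x)\<^sup>2)"
  proof (intro sum.cong refl)
    fix x assume x: "x \<in> A"
    \<comment> \<open>Each row is completed to the constant coefficient \<open>c\<close>, whose
      contribution vanishes by \<open>zero\<close>; only the diagonal correction survives.\<close>
    have "(\<Sum>y\<in>A. ?M x y * (f x * f y)) = (\<Sum>y\<in>A. c * f x * f y + (if y = x then (?M x x - c) * (f x)\<^sup>2 else 0))"
      using c[OF x] by (intro sum.cong) (auto simp: algebra_simps power2_eq_square)
    also have "\<dots> = (?M x x - c) * (f x)\<^sup>2"
      using x fin zero by (simp add: sum.distrib flip: sum_distrib_left)
    finally show "(\<Sum>y\<in>A. ?M x y * (f x * f y)) = (?M x x - c) * (f x)\<^sup>2" .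
  qed
  also have "\<dots> \<le> (\<Sum>x\<in>A. ?M x x)"
  proof (rule sum_mono)
    fix x assume "x \<in> A"
    have "(?M x x - c) * (f x)\<^sup>2 \<le> ?M x x * (f x)\<^sup>2" using c0 by (intro mult_right_mono) auto
    also have "\<dots> \<le> ?M x x" using bnd[OF \<open>x \<in> A\<close>] by (simp add: mult_left_le)
    finally show "(?M x x - c) * (f x)\<^sup>2 \<le> ?M x x" .
  qed
  also have "\<dots> = real m * real (card A choose m)"
  proof (cases "A = {}")
    case True
    thus ?thesis by (cases m) auto
  next
    case False
    have "card A > 0" using False fin by (simp add: card_gt_0_iff)
    have "?M x x = real m * real (card A choose m) / card A" if "x \<in> A" for x
      using card_subsets_containing_point[OF fin that, of m] \<open>card A > 0\<close>
      by (simp add: eq_divide_eq mult.commute flip: of_nat_mult)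
    thus ?thesis using \<open>card A > 0\<close> by simp
  qed
  finally show ?thesis .
qed

text \<open>Chebyshev's inequality for the hypergeometric count \<open>card (X \<inter> B)\<close>:
  subtracting the density \<open>\<beta>\<close> from the indicator of \<open>B\<close> gives a
  function with sum 0, to which the second moment bound applies.\<close>

lemma subset_sampling_deviation:
  assumes fin: "finite A" and B: "B \<subseteq> A" and g: "\<gamma> > 0" and m: "m > 0"
  shows "real (card {X. X \<subseteq> A \<and> card X = m \<and>
           \<bar>real (card (X \<inter> B)) - real m * real (card B) / real (card A)\<bar> > \<gamma> * real m})
    \<le> real (card A choose m) / (\<gamma>\<^sup>2 * real m)"
proof -
  let ?F = "{X. X \<subseteq> A \<and> card X = m}"
  let ?G = "{X. X \<subseteq> A \<and> card X = m \<and>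
           \<bar>real (card (X \<inter> B)) - real m * real (card B) / real (card A)\<bar> > \<gamma> * real m}"
  define \<beta> where "\<beta> = real (card B) / real (card A)"
  define f where "f = (\<lambda>x. indicat_real B x - \<beta>)"
  have \<beta>: "0 \<le> \<beta>" "\<beta> \<le> 1"
    unfolding \<beta>_def using card_mono[OF fin B] by (auto simp: divide_le_eq_1)
  have sf: "sum f X = real (card (X \<inter> B)) - real (card X) * \<beta>" if "X \<subseteq> A" for X
    using finite_subset[OF that fin]
    by (simp add: f_def sum_subtractf indicator_def sum.If_cases Int_def)
  have "sum f A = 0"
    using sf[of A] fin B by (cases "A = {}") (auto simp: \<beta>_def Int_absorb1 f_def)
  moreover have "(f x)\<^sup>2 \<le> 1" for x
    using \<beta> unfolding f_def indicator_def abs_square_le_1 by auto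
  ultimately have 1: "(\<Sum>X\<in>?F. (sum f X)\<^sup>2) \<le> real m * real (card A choose m)"
    using sum_subsets_second_moment[OF fin] by blast
  have "real (card ?G) * (\<gamma> * real m)\<^sup>2 = (\<Sum>X\<in>?G. (\<gamma> * real m)\<^sup>2)" by simp
  also have "\<dots> \<le> (\<Sum>X\<in>?G. (sum f X)\<^sup>2)"
  proof (rule sum_mono)
    fix X assume "X \<in> ?G"
    hence "\<gamma> * real m \<le> \<bar>sum f X\<bar>" using sf[of X] by (auto simp: \<beta>_def)
    thus "(\<gamma> * real m)\<^sup>2 \<le> (sum f X)\<^sup>2"
      using g by (metis abs_ge_zero abs_le_square_iff abs_of_nonneg less_imp_le mult_nonneg_nonneg of_nat_0_le_iff)
  qed
  also have "\<dots> \<le> (\<Sum>X\<in>?F. (sum f X)\<^sup>2)"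
    using fin by (intro sum_mono2) auto
  finally have "real (card ?G) * (\<gamma> * real m)\<^sup>2 \<le> real m * real (card A choose m)"
    using 1 by linarith
  thus ?thesis using g m by (simp add: field_simps power2_eq_square)
qed

section \<open>Basic moves\<close>

text \<open>Splitting the list at the move replaces index updates by concatenation, which suits
  closure under contexts and induction on lists.\<close>

lemma basic_move_iff:
  "basic_move S S' \<longleftrightarrow> (\<exists>U a b V. S = U @ a # b # V \<and> S' = U @ b # a # V)"
proof
  assume "basic_move S S'"
  then obtain x where x: "Suc x < length S" "S' = S[x := S ! Suc x, Suc x := S ! x]"
    unfolding basic_move_def by auto
  define U a b V where "U = take x S" "a = S ! x" "b = S ! Suc x" "V = drop (Suc (Suc x)) S"
  have S: "S = U @ a # b # V"
    using x unfolding U_a_b_V_def by (metis Cons_nth_drop_Suc Suc_lessD append_take_drop_id)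
  have "length U = x" using x U_a_b_V_def by simp
  hence "S' = U @ b # a # V" using x S by (auto simp: list_update_append nth_append)
  thus "\<exists>U a b V. S = U @ a # b # V \<and> S' = U @ b # a # V" using S by blast
next
  assume "\<exists>U a b V. S = U @ a # b # V \<and> S' = U @ b # a # V"
  then obtain U a b V where S: "S = U @ a # b # V" "S' = U @ b # a # V" by blast
  show "basic_move S S'"
    unfolding basic_move_def using S
    by (intro exI[of _ "length U"]) (auto simp: list_update_append nth_append)
qed

lemma basic_move_context:
  "basic_move S S' \<Longrightarrow> basic_move (U @ S @ V) (U @ S' @ V)"
  unfolding basic_move_iff by (metis append.assoc append_Cons)

lemma basic_moves_context:
  "(basic_move ^^ j) S S' \<Longrightarrow> (basic_move ^^ j) (U @ S @ V) (U @ S' @ V)"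
  by (induction j arbitrary: S') (auto intro: basic_move_context)

lemma basic_moves_trans:
  "(basic_move ^^ i) S S' \<Longrightarrow> (basic_move ^^ j) S' S'' \<Longrightarrow> (basic_move ^^ (i + j)) S S''"
  by (auto simp: relpowp_add)

lemma basic_moves_append:
  assumes "(basic_move ^^ i) S S'" "(basic_move ^^ j) T T'"
  shows "(basic_move ^^ (i + j)) (S @ T) (S' @ T')"
  using basic_moves_trans[of i "S @ T" "S' @ T" j "S' @ T'"]
    basic_moves_context[OF assms(1), of "[]" T] basic_moves_context[OF assms(2), of S' "[]"] by simp

text \<open>The letter \<open>a\<close> passes the last letter of \<open>U\<close> first, hence the
  induction from the right.\<close>

lemma basic_moves_to_front: "(basic_move ^^ length U) (U @ a # V) (a # U @ V)"
proof (induction U arbitrary: V rule: rev_induct)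
  case (snoc b U)
  have "basic_move ((U @ [b]) @ a # V) (U @ a # b # V)"
    unfolding basic_move_iff by auto
  moreover have "(basic_move ^^ length U) (U @ a # b # V) (a # U @ b # V)"
    using basic_moves_context[OF snoc[of "b # V"], of "[]" "[]"] by simp
  ultimately have "(basic_move ^^ Suc (length U)) ((U @ [b]) @ a # V) (a # U @ b # V)"
    by (rule relpowp_Suc_I2)
  thus ?case by simp
qed auto

text \<open>The first letter of the target is moved to the front and the rest is treated
  recursively, which costs at most \<open>length S choose 2\<close> moves. The bound is doubled to
  avoid halving.\<close>

lemma basic_moves_permutation:
  assumes "mset S = mset S'"
  shows "\<exists>j. 2 * j \<le> length S * (length S - 1) \<and> (basic_move ^^ j) S S'"
  using assms
proof (induction S' arbitrary: S)
  case Nil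
  thus ?case by auto
next
  case (Cons b T)
  hence "b \<in> set S" by (metis list.set_intros(1) mset_eq_setD)
  then obtain U V where S: "S = U @ b # V" by (meson split_list)
  hence "mset (U @ V) = mset T" using Cons.prems by simp
  then obtain j where j: "2 * j \<le> length (U @ V) * (length (U @ V) - 1)"
      "(basic_move ^^ j) (U @ V) T"
    using Cons.IH by blast
  have "(basic_move ^^ (length U + j)) S (b # T)"
    using basic_moves_trans[OF basic_moves_to_front[of U b V]] basic_moves_context[OF j(2), of "[b]" "[]"] S
    by simp
  moreover have "2 * (length U + j) \<le> length S * (length S - 1)"
  proof -
    let ?l = "length (U @ V)"
    have "2 * (length U + j) \<le> 2 * ?l + ?l * (?l - 1)" using j(1) by simp
    also have "\<dots> = Suc ?l * ?l" by (cases ?l) auto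
    finally show ?thesis using S by simp
  qed
  ultimately show ?case by blast
qed

section \<open>Move counts and the earthmover distance\<close>

lemma length_basic_move: "basic_move S S' \<Longrightarrow> length S' = length S"
  by (auto simp: basic_move_iff)

lemma length_basic_moves: "(basic_move ^^ j) S S' \<Longrightarrow> length S' = length S"
  by (induction j arbitrary: S') (auto dest: length_basic_move)

text \<open>The infimum over move counts is attained. Clearing the denominator is sound below length
  2 too: there the product is 0 and forces \<open>k = 0\<close>, in accordance with the values of
  \<open>0 / 0\<close> and \<open>\<infinity> / 0\<close>; \<open>0 \<le> d\<close> then admits the
  distance 0.\<close>

lemma earthmover_dist_le_iff:
  assumes "0 \<le> d"
  shows "earthmover_dist S S' \<le> ereal d \<longleftrightarrow>
    (\<exists>k. (basic_move ^^ k) S S' \<and> 2 * real k \<le> d * real (length S * (length S - 1)))"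
proof -
  let ?n = "length S" and ?K = "{k. (basic_move ^^ k) S S'}"
  have c: "2 * real (?n choose 2) = real (?n * (?n - 1))"
  proof -
    have "even (?n * (?n - 1))" by (cases ?n) auto
    hence "2 * (?n choose 2) = ?n * (?n - 1)" unfolding choose_two by (rule dvd_mult_div_cancel)
    thus ?thesis by (metis of_nat_mult of_nat_numeral)
  qed
  have div: "ereal (real k) / ereal (real (?n choose 2)) \<le> ereal d \<longleftrightarrow>
      2 * real k \<le> d * real (?n * (?n - 1))" for k
    using assms unfolding c[symmetric]
    by (cases "(?n choose 2) = 0"; cases "k = 0")
      (auto simp: divide_ereal_def field_simps simp del: binomial_eq_0_iff)
  show ?thesis
  proof (cases "?K = {}")
    case True
    hence "earthmover_moves S S' = \<infinity>" by (auto simp: earthmover_moves_def top_enat_def)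
    thus ?thesis using True by (auto simp: earthmover_dist_def)
  next
    case False
    define k where "k = (LEAST k. (basic_move ^^ k) S S')"
    have k: "(basic_move ^^ k) S S'" "\<And>l. (basic_move ^^ l) S S' \<Longrightarrow> k \<le> l"
      using False unfolding k_def by (auto intro: LeastI Least_le)
    have "earthmover_moves S S' = enat k"
      unfolding earthmover_moves_def using k by (intro antisym INF_lower INF_greatest) auto
    hence "earthmover_dist S S' \<le> ereal d \<longleftrightarrow> 2 * real k \<le> d * real (?n * (?n - 1))"
      using div by (simp add: earthmover_dist_def)
    thus ?thesis using k by (meson mult_le_cancel_left_pos of_nat_le_iff order_trans zero_less_numeral)
  qed
qed

section \<open>Canonical tests\<close>

lemma pmf_canonical_test_run:
  "pmf (canonical_test_run q A S) b =
    (\<Sum>X | X \<subseteq> {..<length S} \<and> card X = min q (length S). pmf (A (length S) (nths S X)) b)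
      / real (length S choose min q (length S))"
proof -
  let ?F = "{X. X \<subseteq> {..<length S} \<and> card X = min q (length S)}"
  have "finite ?F" by simp
  moreover have c: "card ?F = length S choose min q (length S)" by (simp add: n_subsets)
  \<comment> \<open>\<open>pmf_of_set\<close> needs a nonempty set; capping the sample size at
    \<open>length S\<close> makes the binomial positive.\<close>
  moreover have "?F \<noteq> {}"
  proof
    assume "?F = {}"
    hence "length S choose min q (length S) = 0" using c by (metis card.empty)
    thus False by simp
  qed
  ultimately show ?thesis
    unfolding canonical_test_run_def pmf_bind by (simp add: integral_pmf_of_set)
qed


section \<open>Stability of acceptance probabilities under basic moves\<close>

lemma nths_cong:
  assumes "\<And>i. i < length l \<Longrightarrow> i \<in> X \<longleftrightarrow> i \<in> Y"
  shows "nths l X = nths l Y"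
proof -
  have "filter (\<lambda>p. snd p \<in> X) (zip l [0..<length l]) = filter (\<lambda>p. snd p \<in> Y) (zip l [0..<length l])"
    using assms by (intro filter_cong) (auto simp: set_zip)
  thus ?thesis by (simp add: nths_def)
qed

text \<open>With at most one of the two positions in \<open>X\<close>, the transposed sample follows
  the moved letter, whose rank among the answers does not change. With both, the two letters would
  be read in exchanged order.\<close>

lemma nths_swap:
  assumes "\<not> (length U \<in> X \<and> Suc (length U) \<in> X)"
  shows "nths (U @ b # a # V) (Transposition.transpose (length U) (Suc (length U)) ` X)
    = nths (U @ a # b # V) X"
proof -
  let ?u = "length U"
  let ?t = "Transposition.transpose ?u (Suc ?u)"
  have t: "y \<in> ?t ` X \<longleftrightarrow> ?t y \<in> X" for y
    using inj_image_mem_iff[OF inj_transpose, of ?u "Suc ?u" "?t y" X] by simp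
  have "nths U (?t ` X) = nths U X"
    by (rule nths_cong) (auto simp: t transpose_apply_other)
  moreover have "{j. Suc (Suc (j + ?u)) \<in> ?t ` X} = {j. Suc (Suc (j + ?u)) \<in> X}"
    by (auto simp: t transpose_apply_other)
  ultimately show ?thesis
    using assms by (auto simp: nths_append nths_Cons t)
qed

text \<open>The transposition permutes the samples of size \<open>m\<close>, which pairs the runs on
  \<open>S\<close> and \<open>S'\<close>. Paired samples give the same answers unless both moved
  positions are sampled, and each exception costs at most 1.\<close>

lemma basic_move_canonical_test_run:
  fixes A :: "nat \<Rightarrow> 'a list \<Rightarrow> bool pmf" and q :: nat
  assumes "basic_move S S'"
  defines "n \<equiv> length S" and "m \<equiv> min q (length S)"
  shows "pmf (canonical_test_run q A S) True
    \<le> pmf (canonical_test_run q A S') True + real (m * (m - 1)) / real (n * (n - 1))"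
proof -
  obtain U a b V where S: "S = U @ a # b # V" "S' = U @ b # a # V"
    using assms(1) by (auto simp: basic_move_iff)
  let ?u = "length U"
  let ?t = "Transposition.transpose ?u (Suc ?u)"
  let ?F = "{X. X \<subseteq> {..<n} \<and> card X = m}"
  let ?B = "{X. X \<subseteq> {..<n} \<and> card X = m \<and> ?u \<in> X \<and> Suc ?u \<in> X}"
  let ?g = "\<lambda>X. pmf (A n (nths S X)) True" and ?g' = "\<lambda>X. pmf (A n (nths S' X)) True"
  have n: "Suc ?u < n" "length S' = n" using S by (auto simp: n_def)
  have mn: "m \<le> n" by (simp add: m_def n_def)
  have finF: "finite ?F" by simp
  have tn: "?t x < n" if "x < n" for x
    using n that by (auto simp: Transposition.transpose_def)
  have tF: "?t ` X \<in> ?F" if "X \<in> ?F" for X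
    using that tn by (auto simp: card_image[OF inj_on_transpose])
  have "bij_betw ((`) ?t) ?F ?F"
    by (rule bij_betw_byWitness[where f' = "(`) ?t"]) (use tF in \<open>auto simp: image_image\<close>)
  hence bij: "(\<Sum>X\<in>?F. ?g' (?t ` X)) = (\<Sum>X\<in>?F. ?g' X)"
    by (rule sum.reindex_bij_betw)
  have "(\<Sum>X\<in>?F. ?g X) \<le> (\<Sum>X\<in>?F. ?g' (?t ` X) + (if ?u \<in> X \<and> Suc ?u \<in> X then 1 else 0))"
  proof (rule sum_mono)
    fix X assume "X \<in> ?F"
    show "?g X \<le> ?g' (?t ` X) + (if ?u \<in> X \<and> Suc ?u \<in> X then 1 else 0)"
    proof (cases "?u \<in> X \<and> Suc ?u \<in> X")
      case True
      have "?g X \<le> 1 + ?g' (?t ` X)" by (intro add_increasing2 pmf_nonneg pmf_le_1)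
      thus ?thesis using True by simp
    next
      case False
      thus ?thesis using nths_swap[OF False, of b a V] S by auto
    qed
  qed
  also have "\<dots> = (\<Sum>X\<in>?F. ?g' X) + real (card ?B)"
    using bij sum.inter_filter[OF finF, of "\<lambda>_. 1::real" "\<lambda>X. ?u \<in> X \<and> Suc ?u \<in> X"]
    by (simp add: sum.distrib conj_assoc)
  finally have "(\<Sum>X\<in>?F. ?g X) \<le> (\<Sum>X\<in>?F. ?g' X) + real (card ?B)" .
  hence "(\<Sum>X\<in>?F. ?g X) / real (n choose m)
      \<le> (\<Sum>X\<in>?F. ?g' X) / real (n choose m) + real (card ?B) / real (n choose m)"
    by (simp add: divide_right_mono flip: add_divide_distrib)
  moreover have "real (card ?B) / real (n choose m) = real (m * (m - 1)) / real (n * (n - 1))"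
  proof -
    have "card ?B * (n * (n - 1)) = (n choose m) * (m * (m - 1))"
      using card_subsets_containing_pair[of "{..<n}" ?u "Suc ?u" m] n by simp
    moreover have "n * (n - 1) \<noteq> 0" "n choose m \<noteq> 0" using n mn by auto
    ultimately show ?thesis
      by (simp add: frac_eq_eq mult.commute flip: of_nat_mult del: mult_eq_0_iff)
  qed
  ultimately show ?thesis
    using n by (simp add: pmf_canonical_test_run n_def m_def)
qed

text \<open>The errors of single moves add up; the length, hence \<open>n\<close> and
  \<open>m\<close>, stays constant along the way.\<close>

lemma basic_moves_canonical_test_run:
  fixes A :: "nat \<Rightarrow> 'a list \<Rightarrow> bool pmf" and q :: nat
  assumes "(basic_move ^^ k) S S'"
  defines "n \<equiv> length S" and "m \<equiv> min q (length S)"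
  shows "pmf (canonical_test_run q A S) True
    \<le> pmf (canonical_test_run q A S') True + real k * (real (m * (m - 1)) / real (n * (n - 1)))"
  using assms(1)
proof (induction k arbitrary: S')
  case (Suc k)
  then obtain T where T: "(basic_move ^^ k) S T" "basic_move T S'" by auto
  have "length T = n" using T(1) length_basic_moves n_def by metis
  thus ?case
    using Suc.IH[OF T(1)] basic_move_canonical_test_run[OF T(2), of q A]
    unfolding n_def m_def by (simp only: of_nat_Suc distrib_right mult_1)
qed simp

text \<open>The assumed distance lets the acceptance probability drop by at most 1/6, because
  \<open>2 k\<close> is at most \<open>?d * n * (n - 1)\<close> and \<open>m * (m - 1)\<close> is at
  most \<open>q * q\<close>. A far \<open>S'\<close> would require a drop of at least 1/3.\<close>

lemma canonical_eps_test_imp_eps_close: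
  assumes test: "canonical_eps_test \<epsilon> P q A" and S: "S \<in> P"
    and d: "earthmover_dist S S' \<le> ereal (1 / (3 * (real q * real q + 1)))"
  shows "eps_close \<epsilon> S' P"
proof
  assume "eps_far \<epsilon> S' P"
  let ?n = "length S"
  let ?m = "min q ?n" and ?d = "1 / (3 * (real q * real q + 1))"
  have q1: "real q * real q + 1 > 0" by (simp add: add_nonneg_pos)
  hence d0: "?d \<ge> 0" by simp
  obtain k where k: "(basic_move ^^ k) S S'" "2 * real k \<le> ?d * real (?n * (?n - 1))"
    using d earthmover_dist_le_iff[OF d0] by blast
  have "real k * (real (?m * (?m - 1)) / real (?n * (?n - 1))) \<le> 1 / 6"
  proof (cases "?n * (?n - 1) = 0")
    \<comment> \<open>The string is too short for a move; division by 0 makes the fraction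
      0.\<close>
    case True
    thus ?thesis by (simp only: of_nat_0 div_by_0 mult_zero_right)
  next
    case False
    hence "real (?n * (?n - 1)) > 0" by linarith
    hence "real k / real (?n * (?n - 1)) \<le> ?d / 2"
      using k(2) by (simp only: divide_le_eq if_True times_divide_eq_left le_divide_eq_numeral1)
    hence "real (?m * (?m - 1)) * (real k / real (?n * (?n - 1))) \<le> real (?m * (?m - 1)) * (?d / 2)"
      by (intro mult_left_mono) auto
    also have "\<dots> \<le> real (q * q) * (?d / 2)"
      using d0 by (intro mult_right_mono of_nat_mono mult_mono) auto
    also have "\<dots> \<le> 1 / 6" using q1 by (simp add: field_simps)
    finally show ?thesis by (simp add: mult.commute)
  qed
  moreover have "pmf (canonical_test_run q A S) True \<ge> 2 / 3"
    using test S unfolding canonical_eps_test_def by blast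
  moreover have "pmf (canonical_test_run q A S') False \<ge> 2 / 3"
    using test \<open>eps_far \<epsilon> S' P\<close> unfolding canonical_eps_test_def by blast
  moreover note basic_moves_canonical_test_run[OF k(1), of q A]
    pmf_False_conv_True[of "canonical_test_run q A S'"]
  ultimately show False by argo
qed

lemma canonically_testable_imp_earthmover_resilient:
  assumes "canonically_testable P"
  shows "earthmover_resilient P"
proof -
  have "\<forall>\<epsilon>. \<exists>q. \<epsilon> > 0 \<longrightarrow> (\<exists>A. canonical_eps_test \<epsilon> P q A)"
    using assms unfolding canonically_testable_def by blast
  then obtain q where q: "\<And>\<epsilon>. \<epsilon> > 0 \<Longrightarrow> \<exists>A. canonical_eps_test \<epsilon> P (q \<epsilon>) A" by metis
  \<comment> \<open>The summand 1 keeps the value strictly between 0 and 1 even for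
    \<open>q \<epsilon> = 0\<close>.\<close>
  define \<delta> where "\<delta> = (\<lambda>\<epsilon>. 1 / (3 * (real (q \<epsilon>) * real (q \<epsilon>) + 1)))"
  have "\<delta> \<epsilon> \<in> {0<..<1}" for \<epsilon>
  proof -
    have "1 < 3 * (real (q \<epsilon>) * real (q \<epsilon>) + 1)"
      by (rule less_le_trans[of _ "3 * 1"]) simp_all
    thus ?thesis unfolding \<delta>_def by simp
  qed
  moreover have "delta_earthmover_resilient \<delta> P"
    unfolding delta_earthmover_resilient_def \<delta>_def
    using q canonical_eps_test_imp_eps_close by fastforce
  ultimately show ?thesis unfolding earthmover_resilient_def by blast
qed

section \<open>Strings with similar block histograms\<close>

text \<open>Unnormalised Hamming distance, so that the values of concatenated blocks add up.\<close>

definition mismatches :: "'a list \<Rightarrow> 'a list \<Rightarrow> nat" where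
  "mismatches S S' = card {x. x < length S \<and> S ! x \<noteq> S' ! x}"

lemma mismatches_append:
  assumes "length A = length A'" "length B = length B'"
  shows "mismatches (A @ B) (A' @ B') = mismatches A A' + mismatches B B'"
proof -
  have zip: "mismatches S S' = length (filter (\<lambda>(a, b). a \<noteq> b) (zip S S'))"
    if "length S = length S'" for S S' :: "'a list"
    using that unfolding mismatches_def length_filter_conv_card
    by (intro arg_cong[where f = card]) auto
  show ?thesis using assms by (simp add: zip)
qed

lemma mismatches_triangle:
  assumes "length S = length T"
  shows "mismatches S U \<le> mismatches S T + mismatches T U"
proof -
  have "mismatches S U \<le> card ({x. x < length S \<and> S ! x \<noteq> T ! x} \<union> {x. x < length T \<and> T ! x \<noteq> U ! x})"
    unfolding mismatches_def using assms by (intro card_mono) auto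
  also have "\<dots> \<le> mismatches S T + mismatches T U"
    unfolding mismatches_def by (rule card_Un_le)
  finally show ?thesis .
qed

text \<open>Greedy choice: a letter still available in \<open>M\<close> is kept; otherwise it is
  surplus and is replaced by a letter of which \<open>M\<close> has too many.\<close>

lemma histogram_correction:
  assumes "size M = length A"
  shows "\<exists>B. mset B = M \<and> mismatches A B \<le> size (mset A - M)"
  using assms
proof (induction A arbitrary: M)
  case Nil
  thus ?case by (auto simp: mismatches_def)
next
  case (Cons a A)
  \<comment> \<open>Common part of both cases: \<open>b\<close> is placed opposite \<open>a\<close>,
    and \<open>le\<close> says that the surplus pays for it.\<close>
  have step: ?case if b: "b \<in># M" and
    le: "(if a = b then 0 else 1) + size (mset A - (M - {#b#})) \<le> size (mset (a # A) - M)" for b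
  proof -
    have "size (M - {#b#}) = length A" using Cons.prems b by (simp add: size_Diff_singleton)
    then obtain B where B: "mset B = M - {#b#}" "mismatches A B \<le> size (mset A - (M - {#b#}))"
      using Cons.IH by blast
    have "length B = length A" using B(1) \<open>size (M - {#b#}) = length A\<close> by (metis size_mset)
    hence "mismatches (a # A) (b # B) = mismatches [a] [b] + mismatches A B"
      using mismatches_append[of "[a]" "[b]" A B] by simp
    also have "mismatches [a] [b] = (if a = b then 0 else 1)"
      by (simp add: mismatches_def conj_commute cong: conj_cong)
    finally have "mismatches (a # A) (b # B) \<le> size (mset (a # A) - M)"
      using B(2) le by linarith
    moreover have "mset (b # B) = M" using B(1) b by simp
    ultimately show ?case by blast
  qed
  show ?case
  proof (cases "a \<in># M")
    case True
    have "mset A - (M - {#a#}) = mset (a # A) - M"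
      using True by (metis add_mset_diff_bothsides insert_DiffM mset.simps(2))
    thus ?thesis using step[OF True] by simp
  next
    case False
    \<comment> \<open>\<open>M\<close> has one element more than \<open>A\<close>, so some
      \<open>b\<close> is in excess; removing it from \<open>M\<close> leaves the surplus of
      \<open>A\<close> unchanged.\<close>
    have "\<not> M \<subseteq># mset A" using Cons.prems size_mset_mono by fastforce
    then obtain b where b: "count M b > count (mset A) b"
      unfolding subseteq_mset_def by (meson not_le)
    hence bM: "b \<in># M" by (metis count_greater_zero_iff gr_zeroI not_less_zero)
    have "mset A - (M - {#b#}) = mset A - M"
      using b by (intro multiset_eqI) auto
    moreover have "mset (a # A) - M = add_mset a (mset A - M)"
      using False by simp
    ultimately show ?thesis using step[OF bM] by simp
  qed
qed

lemma size_mset_diff_le: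
  fixes A B :: "'a::finite list"
  assumes "\<And>a. \<bar>real (count_list A a) - real (count_list B a)\<bar> \<le> d"
  shows "real (size (mset A - mset B)) \<le> real CARD('a) * d"
proof -
  have "size (mset A - mset B) = (\<Sum>a\<in>UNIV. count (mset A - mset B) a)"
    unfolding size_multiset_overloaded_eq
    by (rule sum.mono_neutral_left) (auto simp: not_in_iff simp del: count_diff)
  hence "real (size (mset A - mset B)) = (\<Sum>a\<in>UNIV. real (count (mset A - mset B) a))"
    by simp
  also have "\<dots> \<le> (\<Sum>a\<in>(UNIV::'a set). d)"
  proof (rule sum_mono)
    fix a
    have "real (count (mset A - mset B) a) = real (count_list A a - count_list B a)"
      by (simp add: count_mset)
    also have "\<dots> \<le> d" using assms[of a] by linarith
    finally show "real (count (mset A - mset B) a) \<le> d" .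
  qed
  finally show ?thesis by simp
qed

text \<open>Induction on the number of blocks, cutting off the first \<open>s\<close> letters; the
  last blocks may be short or empty. In each block the letters of \<open>S\<close> are corrected to
  the histogram of \<open>S'\<close>, and the result is a permutation of the block of
  \<open>S'\<close>. The moves start at \<open>S'\<close> because resilience will be applied to
  it.\<close>

lemma block_correction:
  fixes S S' :: "'a::finite list"
  assumes "length S = length S'" "length S \<le> k * s"
    and "\<And>j a. j < k \<Longrightarrow> \<bar>real (count_list (take s (drop (j * s) S)) a)
             - real (count_list (take s (drop (j * s) S')) a)\<bar> \<le> d"
  shows "\<exists>S'' i. length S'' = length S \<and> real (mismatches S S'') \<le> real k * (real CARD('a) * d) \<and>
           i * 2 \<le> k * (s * (s - 1)) \<and> (basic_move ^^ i) S' S''"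
  using assms
proof (induction k arbitrary: S S')
  case 0
  thus ?case by (auto simp: mismatches_def intro!: exI[of _ 0])
next
  case (Suc k)
  define A A' B B' where "A = take s S" "A' = take s S'" "B = drop s S" "B' = drop s S'"
  note AB = A_A'_B_B'_def
  have len: "length A = length A'" "length B = length B'" "length A \<le> s"
    using Suc.prems(1) AB by auto
  have S: "S = A @ B" "S' = A' @ B'" unfolding AB by simp_all
  have "real (size (mset A - mset A')) \<le> real CARD('a) * d"
    by (rule size_mset_diff_le) (use Suc.prems(3)[of 0] AB in simp)
  moreover obtain A'' where A'': "mset A'' = mset A'" "mismatches A A'' \<le> size (mset A - mset A')"
    using histogram_correction[of "mset A'" A] len by auto
  ultimately have misA: "real (mismatches A A'') \<le> real CARD('a) * d" by linarith
  obtain i where i: "2 * i \<le> length A' * (length A' - 1)" "(basic_move ^^ i) A' A''"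
    using basic_moves_permutation[of A' A''] A'' by auto
  have "length A' * (length A' - 1) \<le> s * (s - 1)"
    using len by (intro mult_mono) auto
  hence i2: "i * 2 \<le> s * (s - 1)" using i by linarith
  have "\<exists>B'' j. length B'' = length B \<and> real (mismatches B B'') \<le> real k * (real CARD('a) * d) \<and>
           j * 2 \<le> k * (s * (s - 1)) \<and> (basic_move ^^ j) B' B''"
  proof (rule Suc.IH)
    show "length B \<le> k * s" using Suc.prems(2) AB by simp
    fix j a assume "j < k"
    thus "\<bar>real (count_list (take s (drop (j * s) B)) a)
             - real (count_list (take s (drop (j * s) B')) a)\<bar> \<le> d"
      using Suc.prems(3)[of "Suc j" a] AB by (simp add: add.commute)
  qed (rule len)
  then obtain B'' j where B'': "length B'' = length B" "real (mismatches B B'') \<le> real k * (real CARD('a) * d)"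
      "j * 2 \<le> k * (s * (s - 1))" "(basic_move ^^ j) B' B''"
    by blast
  have lA'': "length A'' = length A" using A''(1) len by (metis size_mset)
  have "real (mismatches S (A'' @ B'')) \<le> real (Suc k) * (real CARD('a) * d)"
    using mismatches_append[of A A'' B B''] lA'' B''(1,2) misA S by (simp add: algebra_simps)
  moreover have "(basic_move ^^ (i + j)) S' (A'' @ B'')"
    using basic_moves_append[OF i(2) B''(4)] S by simp
  moreover have "(i + j) * 2 \<le> Suc k * (s * (s - 1))"
    using i2 B''(3) by simp
  moreover have "length (A'' @ B'') = length S" using lA'' B''(1) S by simp
  ultimately show ?case by blast
qed

section \<open>Representative samples\<close>

text \<open>Prefixes are used rather than blocks, since the answers from a prefix of the string form
  a prefix of all answers, whatever the positions. Block counts are differences of prefix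
  counts.\<close>

definition representative :: "real \<Rightarrow> nat \<Rightarrow> nat \<Rightarrow> 'a list \<Rightarrow> nat set \<Rightarrow> bool" where
  "representative \<gamma> s k S X \<longleftrightarrow> (\<forall>j\<le>k. \<forall>a.
     \<bar>real (count_list (nths (take (j * s) S) X) a)
       - real (card X) * real (count_list (take (j * s) S) a) / real (length S)\<bar> \<le> \<gamma> * real (card X))"

lemma count_list_nths:
  "count_list (nths l X) a = card {x \<in> X. x < length l \<and> l ! x = a}"
proof (induction l rule: rev_induct)
  case (snoc b l)
  have "{x \<in> X. x < length (l @ [b]) \<and> (l @ [b]) ! x = a} = 
      {x \<in> X. x < length l \<and> l ! x = a} \<union> (if length l \<in> X \<and> b = a then {length l} else {})"
    by (auto simp: nth_append less_Suc_eq)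
  also have "card \<dots> = card {x \<in> X. x < length l \<and> l ! x = a} + (if length l \<in> X \<and> b = a then 1 else 0)"
    by (subst card_Un_disjoint) auto
  finally show ?case using snoc by (auto simp: nths_append)
qed auto

lemma count_list_eq_card: "count_list l a = card {x. x < length l \<and> l ! x = a}"
  using count_list_nths[of l UNIV a] by (simp add: nths_all)

text \<open>Union bound over the \<open>k + 1\<close> prefixes and all letters, with the deviation
  bound for the set \<open>?B j a\<close> of occurrences of \<open>a\<close> in a prefix.\<close>

lemma most_samples_representative:
  fixes S :: "'a::finite list"
  assumes g: "\<gamma> > 0" and m: "m > 0"
  shows "real (card {X. X \<subseteq> {..<length S} \<and> card X = m \<and> \<not> representative \<gamma> s k S X})
    \<le> real (Suc k * CARD('a)) * (real (length S choose m) / (\<gamma>\<^sup>2 * real m))"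
proof -
  let ?n = "length S"
  let ?B = "\<lambda>j a. {x. x < ?n \<and> x < j * s \<and> S ! x = a}"
  let ?G = "\<lambda>j a. {X. X \<subseteq> {..<?n} \<and> card X = m \<and>
           \<bar>real (card (X \<inter> ?B j a)) - real m * real (card (?B j a)) / real (card {..<?n})\<bar> > \<gamma> * real m}"
  have 1: "count_list (nths (take (j * s) S) X) a = card (X \<inter> ?B j a)" for j a X
    unfolding count_list_nths by (rule arg_cong[where f = card]) auto
  have 2: "count_list (take (j * s) S) a = card (?B j a)" for j a
    unfolding count_list_eq_card by (rule arg_cong[where f = card]) auto
  have "{X. X \<subseteq> {..<?n} \<and> card X = m \<and> \<not> representative \<gamma> s k S X} \<subseteq> (\<Union>(j, a)\<in>{..k} \<times> UNIV. ?G j a)"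
    unfolding representative_def 1 2 by (auto simp: not_le)
  hence "card {X. X \<subseteq> {..<?n} \<and> card X = m \<and> \<not> representative \<gamma> s k S X} \<le> card (\<Union>(j, a)\<in>{..k} \<times> UNIV. ?G j a)"
    by (intro card_mono) auto
  also have "\<dots> \<le> (\<Sum>(j, a)\<in>{..k} \<times> UNIV. card (?G j a))"
    using card_UN_le[of "{..k} \<times> UNIV" "\<lambda>(j, a). ?G j a"] by (simp add: case_prod_beta)
  finally have "real (card {X. X \<subseteq> {..<?n} \<and> card X = m \<and> \<not> representative \<gamma> s k S X})
      \<le> (\<Sum>p\<in>{..k} \<times> UNIV. real (card (?G (fst p) (snd p))))"
    by (simp add: case_prod_beta flip: of_nat_sum)
  also have "\<dots> \<le> (\<Sum>p\<in>{..k} \<times> (UNIV :: 'a set). real (?n choose m) / (\<gamma>\<^sup>2 * real m))"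
  proof (rule sum_mono)
    fix p :: "nat \<times> 'a"
    have "?B (fst p) (snd p) \<subseteq> {..<?n}" by auto
    from subset_sampling_deviation[OF finite_lessThan this g m]
    show "real (card (?G (fst p) (snd p))) \<le> real (?n choose m) / (\<gamma>\<^sup>2 * real m)"
      by (simp only: card_lessThan)
  qed
  finally show ?thesis by (simp add: card_cartesian_product algebra_simps)
qed

section \<open>Comparing two strings through equal answers\<close>

lemma sum_count_list_UNIV: "(\<Sum>a\<in>UNIV. real (count_list (l :: 'a::finite list) a)) = real (length l)"
  using sum_count_set[of l UNIV] by (simp flip: of_nat_sum)

text \<open>Two prefixes of one list are comparable, and the longer one exceeds the other by a list
  with no more occurrences of \<open>a\<close> than letters.\<close>

lemma count_list_prefix_diff:
  assumes "A @ B = A' @ B'"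
  shows "\<bar>real (count_list A a) - real (count_list A' a)\<bar> \<le> \<bar>real (length A) - real (length A')\<bar>"
proof -
  obtain C where "A = A' @ C \<or> A' = A @ C" using assms by (auto simp: append_eq_append_conv2)
  moreover have "count_list C a \<le> length C" by (rule count_le_length)
  ultimately show ?thesis by auto
qed

text \<open>The answers \<open>T\<close> and \<open>T'\<close> from the two string prefixes are
  prefixes of the same list. Summing the errors over all letters shows that their lengths are close,
  so their letter counts are close as well; two more errors lead back to the strings, with scaling
  factor \<open>n / m\<close>.\<close>

lemma representative_samples_eq:
  fixes S S' :: "'a::finite list"
  assumes len: "length S = length S'" "S \<noteq> []" and card: "card X = m" "card X' = m" "m > 0"
    and eq: "nths S X = nths S' X'"
    and rep: "representative \<gamma> s k S X" "representative \<gamma> s k S' X'" and j: "j \<le> k"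
  shows "\<bar>real (count_list (take (j * s) S) a) - real (count_list (take (j * s) S') a)\<bar>
    \<le> 2 * (real CARD('a) + 1) * \<gamma> * real (length S)"
proof -
  define t \<sigma> n where "t = j * s" "\<sigma> = real CARD('a)" "n = real (length S)"
  define T T' where "T = nths (take t S) X" "T' = nths (take t S') X'"
  define c c' where "c = (\<lambda>a. real m * real (count_list (take t S) a) / n)"
    "c' = (\<lambda>a. real m * real (count_list (take t S') a) / n)"
  note defs = t_\<sigma>_n_def T_T'_def c_c'_def
  have n0: "n > 0" using len(2) defs by simp
  have r: "\<bar>real (count_list T a) - c a\<bar> \<le> \<gamma> * real m" "\<bar>real (count_list T' a) - c' a\<bar> \<le> \<gamma> * real m" for a
    using rep j card len unfolding representative_def defs by simp_all
  \<comment> \<open>The expected numbers of answers agree because both string prefixes have the same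
    length.\<close>
  have "(\<Sum>a\<in>UNIV. c a) = (\<Sum>a\<in>UNIV. c' a)"
    unfolding c_c'_def sum_divide_distrib[symmetric] sum_distrib_left[symmetric] sum_count_list_UNIV
    using len by simp
  hence "real (length T) - real (length T')
      = (\<Sum>a\<in>UNIV. (real (count_list T a) - c a) - (real (count_list T' a) - c' a))"
    unfolding sum_count_list_UNIV[symmetric] by (simp add: sum_subtractf)
  also have "\<bar>\<dots>\<bar> \<le> (\<Sum>a\<in>(UNIV :: 'a set). 2 * (\<gamma> * real m))"
  proof (rule order_trans[OF sum_abs sum_mono])
    fix a show "\<bar>(real (count_list T a) - c a) - (real (count_list T' a) - c' a)\<bar> \<le> 2 * (\<gamma> * real m)"
      using r[of a] by linarith
  qed
  finally have len_diff: "\<bar>real (length T) - real (length T')\<bar> \<le> 2 * \<sigma> * \<gamma> * real m"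
    by (simp add: defs)
  have prefix: "T @ nths (drop t S) {i. i + length (take t S) \<in> X}
      = T' @ nths (drop t S') {i. i + length (take t S') \<in> X'}"
    using eq unfolding T_T'_def by (metis append_take_drop_id nths_append)
  have "\<bar>real (count_list T a) - real (count_list T' a)\<bar> \<le> 2 * \<sigma> * \<gamma> * real m"
    by (rule order_trans[OF count_list_prefix_diff[OF prefix] len_diff])
  hence "\<bar>c a - c' a\<bar> \<le> 2 * \<sigma> * \<gamma> * real m + 2 * (\<gamma> * real m)"
    using r[of a] by linarith
  also have "c a - c' a = real m * (real (count_list (take t S) a) - real (count_list (take t S') a)) / n"
    by (simp add: c_c'_def right_diff_distrib diff_divide_distrib)
  also have "\<bar>\<dots>\<bar> = real m * \<bar>real (count_list (take t S) a) - real (count_list (take t S') a)\<bar> / n"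
    using n0 by (simp add: abs_mult)
  finally have "real m * \<bar>real (count_list (take t S) a) - real (count_list (take t S') a)\<bar>
      \<le> real m * (2 * (\<sigma> + 1) * \<gamma> * n)"
    using n0 by (simp add: divide_le_eq algebra_simps)
  thus ?thesis using card(3) by (simp add: defs)
qed

section \<open>Testing earthmover resilient properties\<close>

text \<open>Serves acceptance with \<open>b = True\<close> and rejection with
  \<open>b = False\<close>: samples outside \<open>Q\<close> are at most a third and are counted as
  failures.\<close>

lemma canonical_test_run_ge:
  assumes n: "n = length S" and m: "m = min q n"
    and good: "\<And>X. X \<subseteq> {..<n} \<Longrightarrow> card X = m \<Longrightarrow> Q X \<Longrightarrow> A n (nths S X) = return_pmf b"
    and bad: "real (card {X. X \<subseteq> {..<n} \<and> card X = m \<and> \<not> Q X}) \<le> real (n choose m) / 3"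
  shows "pmf (canonical_test_run q A S) b \<ge> 2 / 3"
proof -
  let ?F = "{X. X \<subseteq> {..<n} \<and> card X = m}"
  let ?B = "{X. X \<subseteq> {..<n} \<and> card X = m \<and> \<not> Q X}"
  have fin: "finite ?F" by simp
  have C: "real (n choose m) > 0" using m by simp
  have card: "real (card ?F) = real (n choose m)" by (simp add: n_subsets)
  have "(\<Sum>X\<in>?F. 1 - (if \<not> Q X then 1 else 0)) \<le> (\<Sum>X\<in>?F. pmf (A n (nths S X)) b)"
    using good by (intro sum_mono) auto
  moreover have "(\<Sum>X\<in>?F. 1 - (if \<not> Q X then 1 else 0 :: real)) = real (card ?F) - real (card ?B)"
    using sum.inter_filter[OF fin, of "\<lambda>_. 1::real" "\<lambda>X. \<not> Q X"]
    by (simp only: sum_subtractf) (simp add: conj_assoc)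
  ultimately have "real (n choose m) * (2 / 3) \<le> (\<Sum>X\<in>?F. pmf (A n (nths S X)) b)"
    using bad card by linarith
  thus ?thesis
    using C unfolding pmf_canonical_test_run n[symmetric] m[symmetric] by (simp add: le_divide_eq mult.commute)
qed

lemma eps_close_if_hamming_dist_le:
  assumes "Q \<in> P" "length Q = length S" "hamming_dist S Q \<le> \<epsilon>"
  shows "eps_close \<epsilon> S P"
proof -
  have "hamming_dist_property S P \<le> ereal (hamming_dist S Q)"
    unfolding hamming_dist_property_def using assms by (intro INF_lower) auto
  also have "\<dots> \<le> ereal \<epsilon>" using assms by simp
  finally show ?thesis by (simp add: eps_far_def not_less)
qed

text \<open>The strict slack extracts a witness from the infimum without showing that it is
  attained.\<close>

lemma hamming_dist_less_if_eps_close: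
  assumes "eps_close \<epsilon> S P" "\<epsilon> < \<epsilon>'"
  obtains Q where "Q \<in> P" "length Q = length S" "hamming_dist S Q < \<epsilon>'"
proof -
  have "hamming_dist_property S P < ereal \<epsilon>'"
    using assms by (simp add: eps_far_def not_less le_less_trans)
  thus thesis unfolding hamming_dist_property_def using that by (auto simp: INF_less_iff)
qed

text \<open>Of the distance \<open>3 * \<epsilon>\<close>, one \<open>\<epsilon>\<close> pays for
  correcting the block histograms of \<open>S\<close>, and \<open>2 * \<epsilon>\<close> for the way
  from the corrected string to the property.\<close>

lemma representative_samples_imp_eps_close:
  fixes P :: "'a::finite list set"
  assumes res: "delta_earthmover_resilient \<delta> P" and e: "\<epsilon> \<in> {0<..<1}" and k: "real k \<ge> 4 / \<delta> \<epsilon>"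
    and d: "\<delta> \<epsilon> > 0"
    and g: "\<gamma> = \<epsilon> / (4 * real k * real CARD('a) * (real CARD('a) + 1))"
    and s: "s = length S div k + 1"
    and S': "S' \<in> P" "length S' = length S" and n: "length S \<ge> k" "length S \<ge> 2"
    and card: "card X = m" "card X' = m" "m > 0"
    and eq: "nths S X = nths S' X'"
    and rep: "representative \<gamma> s k S X" "representative \<gamma> s k S' X'"
  shows "eps_close (3 * \<epsilon>) S P"
proof -
  let ?n = "length S"
  let ?\<sigma> = "real CARD('a)"
  \<comment> \<open>Twice the error of a prefix count, as a block is the difference of two
    prefixes.\<close>
  define d' where "d' = 4 * (?\<sigma> + 1) * \<gamma> * real ?n"
  have "real k > 0" using k d by (meson divide_pos_pos less_le_trans zero_less_numeral)
  hence k0: "k > 0" by simp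
  have \<sigma>0: "?\<sigma> > 0" by simp
  have ks: "?n \<le> k * s" using dividend_less_div_times[OF k0, of ?n] s by (simp add: algebra_simps)
  have count: "count_list (take (Suc j * s) L) a
      = count_list (take (j * s) L) a + count_list (take s (drop (j * s) L)) a" for j a and L :: "'a list"
    using take_add[of "j * s" s L] by (simp add: add.commute)
  have "\<bar>real (count_list (take s (drop (j * s) S)) a)
             - real (count_list (take s (drop (j * s) S')) a)\<bar> \<le> d'" if "j < k" for j a
  proof -
    have "\<bar>real (count_list (take (i * s) S) a) - real (count_list (take (i * s) S') a)\<bar> \<le> d' / 2"
      if "i \<le> k" for i
    proof -
      have "S \<noteq> []" "d' / 2 = 2 * (?\<sigma> + 1) * \<gamma> * real ?n"
        using n by (auto simp: d'_def)
      thus ?thesis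
        using representative_samples_eq[OF S'(2)[symmetric] _ card eq rep that, of a] by metis
    qed
    from this[of j] this[of "Suc j"] that
    show ?thesis
      unfolding count of_nat_add by linarith
  qed
  then obtain S'' i where S'': "length S'' = ?n" "real (mismatches S S'') \<le> real k * (?\<sigma> * d')"
      "i * 2 \<le> k * (s * (s - 1))" "(basic_move ^^ i) S' S''"
    using block_correction[of S S' k s d'] S' ks by auto
  \<comment> \<open>\<open>\<gamma>\<close> was chosen to make this an equality.\<close>
  have "real k * (?\<sigma> * d') = \<epsilon> * real ?n"
  proof -
    have "4 * real k * ?\<sigma> * (?\<sigma> + 1) \<noteq> 0"
      using \<sigma>0 k0 by (metis add_pos_pos less_irrefl mult_pos_pos of_nat_0_less_iff zero_less_numeral zero_less_one)
    hence "4 * real k * ?\<sigma> * (?\<sigma> + 1) * \<gamma> = \<epsilon>"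
      unfolding g by (rule nonzero_mult_div_cancel_left[THEN trans[OF times_divide_eq_right]])
    thus ?thesis unfolding d'_def by (auto simp: ac_simps)
  qed
  hence dS: "real (mismatches S S'') \<le> \<epsilon> * real ?n" using S''(2) by simp
  have "2 * real i \<le> \<delta> \<epsilon> * real (?n * (?n - 1))"
  proof -
    \<comment> \<open>As \<open>x \<ge> 1\<close>, the block length satisfies
      \<open>s \<le> 2 * x\<close> and \<open>s - 1 \<le> x\<close>. Twice the move count is then at
      most \<open>2 * n * x\<close>, hence at most \<open>\<delta> \<epsilon> * n * n / 2\<close>,
      and \<open>n / 2 \<le> n - 1\<close> for \<open>n \<ge> 2\<close>.\<close>
    define x where "x = real ?n / real k"
    have x: "x \<ge> 1" "real k * x = real ?n" using n k0 by (auto simp: x_def)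
    have "real (?n div k) \<le> x" unfolding x_def by (rule of_nat_div_le_of_nat)
    hence "real (s * (s - 1)) \<le> (2 * x) * x"
      unfolding s using x(1) by (simp only: of_nat_mult) (intro mult_mono, auto)
    moreover have "real i * 2 \<le> real k * real (s * (s - 1))"
      using S''(3) by (metis of_nat_le_iff of_nat_mult of_nat_numeral)
    ultimately have "2 * real i \<le> real k * ((2 * x) * x)"
      using k0 by (smt (verit) mult_left_mono of_nat_0_le_iff)
    also have "\<dots> = 2 * real ?n * x" using x(2) by (simp add: mult.assoc[symmetric])
    also have "\<dots> \<le> 2 * real ?n * (\<delta> \<epsilon> * real ?n / 4)"
    proof (rule mult_left_mono)
      have "4 \<le> real k * \<delta> \<epsilon>" using k d by (simp add: divide_le_eq)
      hence "4 * real ?n \<le> real k * \<delta> \<epsilon> * real ?n" by (rule mult_right_mono) simp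
      thus "x \<le> \<delta> \<epsilon> * real ?n / 4" using k0 unfolding x_def by (simp add: field_simps)
    qed simp
    also have "\<dots> = \<delta> \<epsilon> * (real ?n * (real ?n / 2))" by simp
    also have "\<dots> \<le> \<delta> \<epsilon> * (real ?n * real (?n - 1))"
      using n d by (intro mult_left_mono) auto
    finally show ?thesis by simp
  qed
  hence "earthmover_dist S' S'' \<le> ereal (\<delta> \<epsilon>)"
    using earthmover_dist_le_iff[of "\<delta> \<epsilon>" S' S''] d S''(4) S'(2) by auto
  hence "eps_close \<epsilon> S'' P"
    using res e S'(1) unfolding delta_earthmover_resilient_def by blast
  \<comment> \<open>Any factor above 1 would do; 2 gives the slack for a witness.\<close>
  then obtain Q where Q: "Q \<in> P" "length Q = length S''" "hamming_dist S'' Q < 2 * \<epsilon>"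
    using e by (elim hamming_dist_less_if_eps_close[of _ _ _ "2 * \<epsilon>"]) auto
  have n0: "real ?n > 0" using n by linarith
  have "real (mismatches S'' Q) \<le> 2 * \<epsilon> * real ?n"
    using Q(3) n0 S''(1) unfolding hamming_dist_def mismatches_def by (simp add: divide_less_eq)
  moreover have "real (mismatches S Q) \<le> real (mismatches S S'') + real (mismatches S'' Q)"
    using mismatches_triangle[of S S'' Q] S''(1) by linarith
  ultimately have "real (mismatches S Q) \<le> 3 * \<epsilon> * real ?n" using dS by linarith
  hence "hamming_dist S Q \<le> 3 * \<epsilon>"
    using n0 unfolding hamming_dist_def mismatches_def by (simp add: divide_le_eq)
  thus ?thesis using eps_close_if_hamming_dist_le[of Q P S] Q S''(1) by simp
qed

lemma earthmover_resilient_imp_canonical_eps_test: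
  fixes P :: "'a::finite list set"
  assumes res: "delta_earthmover_resilient \<delta> P" and e: "\<epsilon> \<in> {0<..<1}" and d: "\<delta> \<epsilon> > 0"
  shows "\<exists>q A. canonical_eps_test (3 * \<epsilon>) P q A"
proof -
  define k where "k = nat \<lceil>4 / \<delta> \<epsilon>\<rceil>"
  have k: "real k \<ge> 4 / \<delta> \<epsilon>" unfolding k_def by linarith
  hence "real k > 0" using d by (meson divide_pos_pos less_le_trans zero_less_numeral)
  define \<gamma> where "\<gamma> = \<epsilon> / (4 * real k * real CARD('a) * (real CARD('a) + 1))"
  have g: "\<gamma> > 0" unfolding \<gamma>_def using e \<open>real k > 0\<close> by (simp add: add_pos_pos)
  \<comment> \<open>The first summand makes the failure bound for representative samples at most
    1/3; \<open>k + 1\<close> makes \<open>q < length S\<close> imply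
    \<open>length S \<ge> k\<close> and \<open>length S \<ge> 2\<close>.\<close>
  define q where "q = nat \<lceil>3 * real (Suc k * CARD('a)) / \<gamma>\<^sup>2\<rceil> + k + 1"
  have q: "real q \<ge> 3 * real (Suc k * CARD('a)) / \<gamma>\<^sup>2" "q > k" "q > 0"
    unfolding q_def by linarith+
  \<comment> \<open>Strings of length at most \<open>q\<close> are read completely, so every sample
    counts as good there.\<close>
  define rep where "rep = (\<lambda>(S::'a list) X. q < length S \<longrightarrow> representative \<gamma> (length S div k + 1) k S X)"
  define sample where "sample = (\<lambda>(S::'a list) T. \<exists>X. X \<subseteq> {..<length S} \<and> card X = min q (length S)
    \<and> T = nths S X \<and> rep S X)"
  \<comment> \<open>A deterministic rule that uses the known length. For \<open>S\<close> in the
    property, \<open>S\<close> itself witnesses acceptance on each good sample.\<close>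
  define A where "A = (\<lambda>n T. return_pmf (\<exists>S\<in>P. length S = n \<and> sample S T))"
  have bad: "real (card {X. X \<subseteq> {..<length S} \<and> card X = min q (length S) \<and> \<not> rep S X})
      \<le> real (length S choose min q (length S)) / 3" for S
  proof (cases "q < length S")
    case False
    have "{X. X \<subseteq> {..<length S} \<and> card X = min q (length S) \<and> \<not> rep S X} = {}"
      using False by (auto simp: rep_def)
    thus ?thesis by (simp only: card.empty of_nat_0 zero_le_divide_iff) simp
  next
    case True
    let ?C = "real (length S choose q)"
    have "real (Suc k * CARD('a)) / (\<gamma>\<^sup>2 * real q) \<le> 1 / 3"
      using q g by (simp add: divide_le_eq mult.commute)
    hence "?C * (real (Suc k * CARD('a)) / (\<gamma>\<^sup>2 * real q)) \<le> ?C * (1 / 3)"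
      by (rule mult_left_mono) simp
    thus ?thesis
      using most_samples_representative[OF g q(3), of S "length S div k + 1" k] True
      by (simp add: rep_def mult.commute)
  qed
  have "pmf (canonical_test_run q A S) True \<ge> 2 / 3" if "S \<in> P" for S
    by (rule canonical_test_run_ge[OF refl refl _ bad]) (use that in \<open>auto simp: A_def sample_def\<close>)
  moreover have "pmf (canonical_test_run q A S) False \<ge> 2 / 3" if far: "eps_far (3 * \<epsilon>) S P" for S
  proof (rule canonical_test_run_ge[OF refl refl _ bad])
    fix X assume X: "X \<subseteq> {..<length S}" "card X = min q (length S)" "rep S X"
    have False if S': "S' \<in> P" "length S' = length S" "sample S' (nths S X)" for S'
    proof -
      obtain X' where X': "X' \<subseteq> {..<length S}" "card X' = min q (length S)"
          "nths S X = nths S' X'" "rep S' X'"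
        using S'(2,3) unfolding sample_def by auto
      show False
      proof (cases "q < length S")
        case True
        have "eps_close (3 * \<epsilon>) S P"
          by (rule representative_samples_imp_eps_close[OF res e k d \<gamma>_def refl S'(1,2) _ _ _ _ q(3) X'(3)])
            (use True q X X' S'(2) in \<open>auto simp: rep_def\<close>)
        thus False using far by simp
      next
        \<comment> \<open>Both samples consist of all positions, so the answers determine the string
          and \<open>S\<close> lies in the property.\<close>
        case False
        hence "X = {..<length S}" "X' = {..<length S}"
          using X X' card_subset_eq[of "{..<length S}"] by auto
        hence "S = S'" using X'(3) S'(2) by simp
        hence "eps_close (3 * \<epsilon>) S P"
          using eps_close_if_hamming_dist_le[of S P S "3 * \<epsilon>"] S'(1) e by (simp add: hamming_dist_def)
        thus False using far by simp
      qed
    qed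
    thus "A (length S) (nths S X) = return_pmf False" unfolding A_def by auto
  qed
  ultimately show ?thesis unfolding canonical_eps_test_def by blast
qed

lemma eps_far_mono: "eps_far \<epsilon> S P \<Longrightarrow> \<epsilon>' \<le> \<epsilon> \<Longrightarrow> eps_far \<epsilon>' S P"
  unfolding eps_far_def by (meson ereal_less_eq(3) le_less_trans)

theorem theorem2:
  fixes P :: "'a::finite list set"
  shows "canonically_testable P \<longleftrightarrow> earthmover_resilient P"
proof
  show "canonically_testable P \<Longrightarrow> earthmover_resilient P"
    by (rule canonically_testable_imp_earthmover_resilient)
next
  assume "earthmover_resilient P"
  then obtain \<delta> where \<delta>: "\<delta> \<in> {0<..<1} \<rightarrow> {0<..<1}" "delta_earthmover_resilient \<delta> P"
    unfolding earthmover_resilient_def by blast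
  show "canonically_testable P"
    unfolding canonically_testable_def
  proof (intro allI impI)
    fix \<epsilon> :: real assume "\<epsilon> > 0"
    \<comment> \<open>Canonical testability allows \<open>\<epsilon> \<ge> 1\<close>, resilience
      does not, hence the minimum; the division offsets the factor 3 of the test.\<close>
    define \<epsilon>' where "\<epsilon>' = min \<epsilon> 1 / 3"
    have e: "\<epsilon>' \<in> {0<..<1}" "3 * \<epsilon>' \<le> \<epsilon>" using \<open>\<epsilon> > 0\<close> by (auto simp: \<epsilon>'_def)
    have "\<delta> \<epsilon>' > 0" using \<delta>(1) e(1) by (auto simp: Pi_iff)
    then obtain q A where "canonical_eps_test (3 * \<epsilon>') P q A"
      using earthmover_resilient_imp_canonical_eps_test[OF \<delta>(2) e(1)] by blast
    hence "canonical_eps_test \<epsilon> P q A"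
      using eps_far_mono[OF _ e(2)] unfolding canonical_eps_test_def by blast
    thus "\<exists>q A. canonical_eps_test \<epsilon> P q A" by blast
  qed
qed

end
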